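(* Let $Q=(q_{ij})$ be the transition matrix of a discrete-time, time-homogeneous Markov chain on a finite state space $S$, let $i\in S$ be a fixed initial state, let $k$ be a field, and let $n\ge 1$ be an integer. Let $J_n(i)\subseteq k[x_s:s\in S]$ be the occupation ideal, generated by the monomials $m_\gamma$ over all admissible trajectories $\gamma$ of length $n$ starting at $i$. Then all minimal monomial generators of $J_n(i)$ have total degree $n+1$. Consequently, \[ a_i(n)=\mu(J_n(i)), \] where $a_i(n)$ is the number of distinct occupation vectors of admissible trajectories of length $n$ starting at $i$, and $\mu(J_n(i))$ is the number of minimal monomial generators of $J_n(i)$.
   Context: The support graph of $Q$ is the directed graph $G_B=(S,E)$ with $E=\{(s,t)\in S\times S: q_{st}>0\}$ (loops allowed). An admissible trajectory of length $n$ starting at $i$ is a sequence $\gamma=(i_0,i_1,\ldots,i_n)$ of states with $i_0=i$ and $(i_{r},i_{r+1})\in E$ for all $0\le r<n$. It is regarded as the word $w_\gamma=i_0i_1\cdots i_n$ over the alphabet $S$, and $L_i^{(n)}$ denotes the set of all such words (identified with the trajectories) for the given $n$. The occupation vector (Parikh vector) of $\gamma$ is $\Psi(w_\gamma)=(\alpha_s)_{s\in S}\in\mathbb{N}^{S}$, where $\alpha_s=\#\{r\in\{0,\ldots,n\}: i_r=s\}$. The monomial associated with $\gamma$ is $m_\gamma=\prod_{s\in S}x_s^{\alpha_s}$ in the polynomial ring $R=k[x_s:s\in S]$, with one variable per state. The occupation ideal is $J_n(i)=\langle m_\gamma:\gamma\in L_i^{(n)}\rangle\subseteq R$. The occupation-pattern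 growth function is $a_i(n)=\#\{\Psi(w): w\in L_i^{(n)}\}$. The minimal monomial generators of a monomial ideal are the elements of its unique minimal generating set of monomials (the monomials in the ideal that are minimal with respect to divisibility). *)

theory Defs
  imports "HOL-Analysis.Finite_Cartesian_Product" "HOL-Library.Poly_Mapping"
begin

(* Rows index the current state: Q $ s $ t is the probability of moving from s to t. *)
definition transition_matrix :: "real ^ 's::finite ^ 's \<Rightarrow> bool" where
  "transition_matrix Q \<longleftrightarrow> (\<forall>s t. 0 \<le> Q $ s $ t) \<and> (\<forall>s. (\<Sum>t\<in>UNIV. Q $ s $ t) = 1)"

definition support_edges :: "real ^ 's::finite ^ 's \<Rightarrow> ('s \<times> 's) set" where
  "support_edges Q = {(s, t). Q $ s $ t > 0}"

(* A trajectory of length n makes n steps, so its word has n + 1 letters. *)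
definition trajectories :: "real ^ 's::finite ^ 's \<Rightarrow> 's \<Rightarrow> nat \<Rightarrow> 's list set" where
  "trajectories Q i n =
     {w. length w = n + 1 \<and> w ! 0 = i \<and> (\<forall>r<n. (w ! r, w ! Suc r) \<in> support_edges Q)}"

definition occupation_vector :: "'s list \<Rightarrow> 's \<Rightarrow> nat" where
  "occupation_vector w s = card {r. r < length w \<and> w ! r = s}"

definition occupation_growth :: "real ^ 's::finite ^ 's \<Rightarrow> 's \<Rightarrow> nat \<Rightarrow> nat" where
  "occupation_growth Q i n = card (occupation_vector ` trajectories Q i n)"

(* The polynomial ring k[x_s : s in S], as the monoid algebra of the exponent vectors over k. *)
type_synonym ('s, 'k) mpoly = "('s \<Rightarrow>\<^sub>0 nat) \<Rightarrow>\<^sub>0 'k"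

definition mvar :: "'s \<Rightarrow> ('s, 'k::comm_ring_1) mpoly" where
  "mvar s = Poly_Mapping.single (Poly_Mapping.single s 1) 1"

definition mmonom :: "('s::finite \<Rightarrow> nat) \<Rightarrow> ('s, 'k::comm_ring_1) mpoly" where
  "mmonom \<alpha> = (\<Prod>s\<in>UNIV. mvar s ^ \<alpha> s)"

definition total_degree :: "('s, 'k::zero) mpoly \<Rightarrow> nat" where
  "total_degree p =
     Max (insert 0 ((\<lambda>\<alpha>. \<Sum>s\<in>Poly_Mapping.keys \<alpha>. Poly_Mapping.lookup \<alpha> s) ` Poly_Mapping.keys p))"

lemma module_mult: "module ((*) :: 'a \<Rightarrow> 'a \<Rightarrow> 'a::comm_ring_1)"
  by unfold_locales (simp_all add: algebra_simps)

(* Ideals are the submodules of the ring regarded as a module over itself. *)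
definition ideal_generated :: "'a::comm_ring_1 set \<Rightarrow> 'a set" where
  "ideal_generated B = module.span (*) B"

definition occupation_ideal ::
    "real ^ 's::finite ^ 's \<Rightarrow> 's \<Rightarrow> nat \<Rightarrow> ('s, 'k::field) mpoly set" where
  "occupation_ideal Q i n =
     ideal_generated ((\<lambda>w. mmonom (occupation_vector w)) ` trajectories Q i n)"

definition min_monomial_gens :: "('s::finite, 'k::field) mpoly set \<Rightarrow> ('s, 'k) mpoly set" where
  "min_monomial_gens I =
     {m \<in> I \<inter> range mmonom. \<forall>m' \<in> I \<inter> range mmonom. m' dvd m \<longrightarrow> m' = m}"

definition num_min_gens :: "('s::finite, 'k::field) mpoly set \<Rightarrow> nat" where
  "num_min_gens I = card (min_monomial_gens I)"

end

theory Submission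
  imports Defs
begin

text \<open>A monomial lies in a monomial ideal iff one of the generating monomials divides it.
  Occupation vectors of words with \<open>n + 1\<close> letters all have sum \<open>n + 1\<close>, and two comparable
  exponent vectors with the same sum coincide. Hence the generators \<open>m\<^sub>\<gamma>\<close> form an antichain for
  divisibility and are exactly the minimal monomial generators.\<close>

lemma mvar_power:
  "mvar s ^ k = (Poly_Mapping.single (Poly_Mapping.single s k) 1 :: ('s, 'k::comm_ring_1) mpoly)"
  by (induction k) (simp_all add: mvar_def mult_single single_add[symmetric] single_one)

lemma prod_single_one:
  assumes "finite A"
  shows "(\<Prod>s\<in>A. Poly_Mapping.single (f s) 1)
    = (Poly_Mapping.single (\<Sum>s\<in>A. f s) 1 :: ('s, 'k::comm_ring_1) mpoly)"
  using assms by (induction A) (simp_all add: mult_single)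

text \<open>Each monomial is one basis element of the monoid algebra. As the type \<open>'s\<close>
  is finite, every exponent function has finite support, so \<open>Abs_poly_mapping\<close> loses
  nothing.\<close>

lemma mmonom_eq_single:
  fixes \<alpha> :: "'s::finite \<Rightarrow> nat"
  shows "mmonom \<alpha> = (Poly_Mapping.single (Abs_poly_mapping \<alpha>) 1 :: ('s, 'k::comm_ring_1) mpoly)"
proof -
  have "(\<Sum>s\<in>UNIV. Poly_Mapping.single s (\<alpha> s)) = Abs_poly_mapping \<alpha>"
    by (rule poly_mapping_eqI) (simp add: lookup_sum lookup_single when_def)
  then show ?thesis
    by (simp add: mmonom_def mvar_power prod_single_one)
qed

lemma keys_mmonom:
  "Poly_Mapping.keys (mmonom \<alpha> :: ('s::finite, 'k::comm_ring_1) mpoly) = {Abs_poly_mapping \<alpha>}"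
  by (simp add: mmonom_eq_single)

text \<open>The exponent vector is recovered as the only key. This lets generators be counted by
  their exponents.\<close>

lemma mmonom_inject [simp]:
  fixes \<alpha> \<beta> :: "'s::finite \<Rightarrow> nat"
  shows "(mmonom \<alpha> :: ('s, 'k::comm_ring_1) mpoly) = mmonom \<beta> \<longleftrightarrow> \<alpha> = \<beta>"
proof
  assume "(mmonom \<alpha> :: ('s, 'k) mpoly) = mmonom \<beta>"
  then have "Abs_poly_mapping \<alpha> = Abs_poly_mapping \<beta>"
    using keys_mmonom[where 'k='k] by (metis singleton_inject)
  then have "Poly_Mapping.lookup (Abs_poly_mapping \<alpha>) = Poly_Mapping.lookup (Abs_poly_mapping \<beta>)"
    by simp
  then show "\<alpha> = \<beta>"
    by simp
qed simp

lemma mmonom_add: "mmonom (\<lambda>s. \<alpha> s + \<beta> s) = mmonom \<alpha> * mmonom \<beta>"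
  by (simp add: mmonom_def power_add prod.distrib)

lemma total_degree_mmonom:
  fixes \<alpha> :: "'s::finite \<Rightarrow> nat"
  shows "total_degree (mmonom \<alpha> :: ('s, 'k::comm_ring_1) mpoly) = (\<Sum>s\<in>UNIV. \<alpha> s)"
proof -
  \<comment> \<open>\<open>total_degree\<close> sums over the support only; exponents off the
    support are 0.\<close>
  have "(\<Sum>s\<in>Poly_Mapping.keys (Abs_poly_mapping \<alpha>). \<alpha> s) = (\<Sum>s\<in>UNIV. \<alpha> s)"
    by (rule sum.mono_neutral_left) (auto simp: in_keys_iff)
  then show ?thesis
    by (simp add: total_degree_def keys_mmonom)
qed

text \<open>Induction over the span needs a claim about every term of an arbitrary element, since
  sums of monomials need not be monomials. Multiplying by a ring element only raises exponents, and
  addition creates no new keys.\<close>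

lemma keys_ideal_generated_mmonom:
  fixes p :: "('s::finite, 'k::comm_ring_1) mpoly"
  assumes "p \<in> ideal_generated (mmonom ` V)" and "t \<in> Poly_Mapping.keys p"
  shows "\<exists>\<alpha>\<in>V. \<forall>s. \<alpha> s \<le> Poly_Mapping.lookup t s"
proof -
  interpret module "(*) :: ('s, 'k) mpoly \<Rightarrow> _"
    by (rule module_mult)
  have "\<forall>t\<in>Poly_Mapping.keys p. \<exists>\<alpha>\<in>V. \<forall>s. \<alpha> s \<le> Poly_Mapping.lookup t s"
    using assms(1) unfolding ideal_generated_def
  proof (induction rule: span_induct_alt)
    case base
    then show ?case by simp
  next
    case (step c x y)
    then obtain \<alpha> where \<alpha>: "\<alpha> \<in> V" "x = mmonom \<alpha>"
      by auto
    have "\<forall>s. \<alpha> s \<le> Poly_Mapping.lookup t s" if "t \<in> Poly_Mapping.keys (c * x)" for t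
    proof -
      \<comment> \<open>Keys of a product are sums of keys of its factors, and \<open>x\<close> has
        a single key; \<open>a\<close> is a key of \<open>c\<close>.\<close>
      from that obtain a where "t = a + Abs_poly_mapping \<alpha>"
        using keys_mult[of c x] by (auto simp: \<alpha> keys_mmonom)
      then show ?thesis
        by (simp add: lookup_add)
    qed
    then show ?case
      using keys_add[of "c * x" y] step.IH \<alpha>(1) by blast
  qed
  then show ?thesis
    using assms(2) by blast
qed

lemma mmonom_in_ideal_generatedD:
  assumes "(mmonom \<beta> :: ('s::finite, 'k::comm_ring_1) mpoly) \<in> ideal_generated (mmonom ` V)"
  obtains \<alpha> where "\<alpha> \<in> V" "\<alpha> \<le> \<beta>"
  using keys_ideal_generated_mmonom[OF assms, of "Abs_poly_mapping \<beta>"]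
  by (auto simp: keys_mmonom le_fun_def)

lemma mmonom_dvd_iff:
  fixes \<alpha> \<beta> :: "'s::finite \<Rightarrow> nat"
  shows "(mmonom \<alpha> :: ('s, 'k::comm_ring_1) mpoly) dvd mmonom \<beta> \<longleftrightarrow> \<alpha> \<le> \<beta>"
proof
  assume "(mmonom \<alpha> :: ('s, 'k) mpoly) dvd mmonom \<beta>"
  then obtain q where q: "(mmonom \<beta> :: ('s, 'k) mpoly) = q * mmonom \<alpha>"
    by (metis dvdE mult.commute)
  interpret module "(*) :: ('s, 'k) mpoly \<Rightarrow> _"
    by (rule module_mult)
  \<comment> \<open>Divisibility is membership in a principal ideal, so the membership criterion
    applies with one generator.\<close>
  have "(mmonom \<beta> :: ('s, 'k) mpoly) \<in> ideal_generated (mmonom ` {\<alpha>})"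
    unfolding q ideal_generated_def by (intro span_scale span_base) simp
  then show "\<alpha> \<le> \<beta>"
    by (rule mmonom_in_ideal_generatedD) simp
next
  assume "\<alpha> \<le> \<beta>"
  \<comment> \<open>The exponent of the quotient; truncated subtraction is exact because \<alpha>
    \<le> \<beta> pointwise.\<close>
  then have "\<beta> = (\<lambda>s. \<alpha> s + (\<beta> s - \<alpha> s))"
    by (auto simp: le_fun_def)
  then show "(mmonom \<alpha> :: ('s, 'k) mpoly) dvd mmonom \<beta>"
    by (metis dvd_triv_left mmonom_add)
qed

lemma min_monomial_gens_antichain:
  fixes V :: "('s::finite \<Rightarrow> nat) set"
  assumes antichain: "\<And>\<alpha> \<beta>. \<alpha> \<in> V \<Longrightarrow> \<beta> \<in> V \<Longrightarrow> \<alpha> \<le> \<beta> \<Longrightarrow> \<alpha> = \<beta>"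
  shows "min_monomial_gens (ideal_generated (mmonom ` V) :: ('s, 'k::field) mpoly set) = mmonom ` V"
    (is "min_monomial_gens ?I = _")
proof (intro equalityI subsetI)
  interpret module "(*) :: ('s, 'k) mpoly \<Rightarrow> _"
    by (rule module_mult)
  have gen: "mmonom \<alpha> \<in> ?I" if "\<alpha> \<in> V" for \<alpha>
    using that unfolding ideal_generated_def by (intro span_base) simp
  {
    fix m assume m: "m \<in> min_monomial_gens ?I"
    then obtain \<beta> where \<beta>: "m = mmonom \<beta>" "mmonom \<beta> \<in> ?I"
      by (auto simp: min_monomial_gens_def)
    from \<beta>(2) obtain \<alpha> where "\<alpha> \<in> V" "\<alpha> \<le> \<beta>"
      by (rule mmonom_in_ideal_generatedD)
    then have "mmonom \<alpha> \<in> ?I \<inter> range mmonom" "mmonom \<alpha> dvd m"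
      using gen by (auto simp: \<beta>(1) mmonom_dvd_iff)
    then have "mmonom \<alpha> = m"
      using m unfolding min_monomial_gens_def by blast
    with \<open>\<alpha> \<in> V\<close> show "m \<in> mmonom ` V"
      by blast
  next
    fix m :: "('s, 'k) mpoly" assume "m \<in> mmonom ` V"
    then obtain \<alpha> where \<alpha>: "\<alpha> \<in> V" "m = mmonom \<alpha>"
      by auto
    have "\<beta> = \<alpha>" if "mmonom \<beta> \<in> ?I" "\<beta> \<le> \<alpha>" for \<beta>
    proof -
      \<comment> \<open>Any monomial of the ideal lying below \<alpha> is trapped between two
        members of \<open>V\<close>, which the antichain condition forces to coincide.\<close>
      from that(1) obtain \<gamma> where \<gamma>: "\<gamma> \<in> V" "\<gamma> \<le> \<beta>"
        by (rule mmonom_in_ideal_generatedD)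
      then have "\<gamma> = \<alpha>"
        using that(2) \<alpha>(1) by (intro antichain) (auto intro: order_trans)
      with \<gamma>(2) that(2) show ?thesis
        by (simp add: order_antisym)
    qed
    with gen \<alpha> show "m \<in> min_monomial_gens ?I"
      by (auto simp: min_monomial_gens_def mmonom_dvd_iff)
  }
qed

lemma le_fun_sum_eq_imp_eq:
  fixes \<alpha> \<beta> :: "'s::finite \<Rightarrow> nat"
  assumes "\<alpha> \<le> \<beta>" and "(\<Sum>s\<in>UNIV. \<alpha> s) = (\<Sum>s\<in>UNIV. \<beta> s)"
  shows "\<alpha> = \<beta>"
proof (rule ccontr)
  assume "\<alpha> \<noteq> \<beta>"
  then obtain s where "\<alpha> s < \<beta> s"
    using assms(1) by (auto simp: fun_eq_iff le_fun_def order.strict_iff_order)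
  then have "(\<Sum>s\<in>UNIV. \<alpha> s) < (\<Sum>s\<in>UNIV. \<beta> s)"
    using assms(1) by (intro sum_strict_mono_ex1) (auto simp: le_fun_def)
  with assms(2) show False
    by simp
qed

lemma sum_occupation_vector: "(\<Sum>s\<in>UNIV. occupation_vector w s) = length (w :: 's::finite list)"
proof -
  \<comment> \<open>The positions of \<open>w\<close> are partitioned according to the letter they
    carry.\<close>
  have "(\<Sum>s\<in>UNIV. occupation_vector w s) = card (\<Union>s. {r. r < length w \<and> w ! r = s})"
    unfolding occupation_vector_def by (rule card_UN_disjoint[symmetric]) auto
  also have "(\<Union>s. {r. r < length w \<and> w ! r = s}) = {..<length w}"
    by auto
  finally show ?thesis
    by simp
qed

theorem proposition4p1:
  fixes Q :: "real ^ 's::finite ^ 's" and i :: 's and n :: nat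
    and J :: "('s, 'k::field) mpoly set"
  assumes "transition_matrix Q" and "n \<ge> 1"
    and "J = occupation_ideal Q i n"
  shows "(\<forall>m \<in> min_monomial_gens J. total_degree m = n + 1)
       \<and> occupation_growth Q i n = num_min_gens J"
proof -
  \<comment> \<open>Trajectories with equal occupation vectors are merged here, so
    \<open>card V\<close> is the growth function while \<open>mmonom\<close> maps \<open>V\<close>
    onto the generators of \<open>J\<close>.\<close>
  define V where "V = occupation_vector ` trajectories Q i n"
  have deg: "(\<Sum>s\<in>UNIV. \<alpha> s) = n + 1" if "\<alpha> \<in> V" for \<alpha>
    using that by (auto simp: V_def trajectories_def sum_occupation_vector)
  have "J = ideal_generated (mmonom ` V)"
    by (simp add: assms(3) occupation_ideal_def V_def image_image)
  moreover have "\<alpha> = \<beta>" if "\<alpha> \<in> V" "\<beta> \<in> V" "\<alpha> \<le> \<beta>" for \<alpha> \<beta>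
    using that deg by (intro le_fun_sum_eq_imp_eq) auto
  ultimately have gens: "min_monomial_gens J = mmonom ` V"
    by (simp add: min_monomial_gens_antichain)
  have "card (mmonom ` V :: ('s, 'k) mpoly set) = card V"
    by (intro card_image inj_onI) simp
  then show ?thesis
    using deg by (auto simp: gens total_degree_mmonom num_min_gens_def occupation_growth_def V_def)
qed

end
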